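(* There exist absolute constants $C,k>0$ and, for every $n\ge 2$, a deterministic online algorithm for stochastic online sorting with $n$ items and $n$ cells such that, with probability at least $1-C/n^{10}$ over the random input, the cost of the algorithm is at most $C\log^k n$ (i.e., with probability $1-O(1/n^{10})$ the cost is $\mathrm{poly}\log n$).
   Context: Stochastic online sorting: there is an array $A$ of $n$ initially empty cells. Items $x_1,\dots,x_n$ arrive one at a time, each drawn independently and uniformly at random from $[0,1]$. When item $x_t$ arrives, the algorithm must immediately and irrevocably place it into a currently empty cell; a deterministic algorithm chooses this cell as a function of $x_1,\dots,x_t$ only (and its own previous choices). After all $n$ items are placed, the cost is $\sum_{i=1}^{n-1}|A[i+1]-A[i]|$. *)

theory Defs
  imports "HOL-Probability.Probability"
begin

text \<open>
  Cells and items are both numbered from \<open>1\<close> to \<open>n\<close>. An algorithm maps the history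
  \<open>[x\<^sub>1, \<dots>, x\<^sub>t]\<close>, whose last entry is the item that has just arrived, to the cell receiving
  that item. The earlier choices are the values on proper prefixes of the history, so they need
  not be passed explicitly. The array is a partial map; an empty cell has value \<^term>\<open>None\<close>.
\<close>

type_synonym online_alg = "real list \<Rightarrow> nat"

definition chosen_cell :: "online_alg \<Rightarrow> (nat \<Rightarrow> real) \<Rightarrow> nat \<Rightarrow> nat" where
  "chosen_cell alg x t = alg (map x [1..<Suc t])"

primrec array_after :: "online_alg \<Rightarrow> (nat \<Rightarrow> real) \<Rightarrow> nat \<Rightarrow> (nat \<rightharpoonup> real)" where
  "array_after alg x 0 = Map.empty"
| "array_after alg x (Suc t) = (array_after alg x t)(chosen_cell alg x (Suc t) \<mapsto> x (Suc t))"

definition valid_online_alg :: "nat \<Rightarrow> online_alg \<Rightarrow> bool" where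
  "valid_online_alg n alg \<longleftrightarrow>
     (\<forall>x. (\<forall>t\<in>{1..n}. x t \<in> {0..1}) \<longrightarrow>
       (\<forall>t\<in>{1..n}. chosen_cell alg x t \<in> {1..n} \<and>
                    array_after alg x (t - 1) (chosen_cell alg x t) = None))"

definition sorting_cost :: "nat \<Rightarrow> online_alg \<Rightarrow> (nat \<Rightarrow> real) \<Rightarrow> real" where
  "sorting_cost n alg x =
     (\<Sum>i = 1..<n. \<bar>the (array_after alg x n (i + 1)) - the (array_after alg x n i)\<bar>)"

definition uniform_items :: "nat \<Rightarrow> (nat \<Rightarrow> real) measure" where
  "uniform_items n = (\<Pi>\<^sub>M t\<in>{1..n}. uniform_measure lborel {0..1})"

lemma prob_space_uniform_items: "prob_space (uniform_items n)"
  unfolding uniform_items_def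
  by (intro prob_space_PiM prob_space_uniform_measure) auto

lemma dom_array_after:
  assumes valid: "valid_online_alg n alg" and x: "\<forall>t\<in>{1..n}. x t \<in> {0..1}"
  shows "dom (array_after alg x n) = {1..n}"
proof -
  have c: "chosen_cell alg x t \<in> {1..n}" "chosen_cell alg x t \<notin> dom (array_after alg x (t - 1))"
    if "t \<in> {1..n}" for t
    using valid[unfolded valid_online_alg_def, rule_format, of x t] x that by (simp_all add: domIff)
  have "dom (array_after alg x t) \<subseteq> {1..n} \<and> card (dom (array_after alg x t)) = t" if "t \<le> n" for t
    using that
  proof (induction t)
    case (Suc t)
    let ?D = "dom (array_after alg x t)" and ?c = "chosen_cell alg x (Suc t)"
    have IH: "?D \<subseteq> {1..n}" "card ?D = t"
      using Suc by simp_all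
    have c: "?c \<in> {1..n}" "?c \<notin> ?D"
      using c[of "Suc t"] Suc.prems by simp_all
    have D: "dom (array_after alg x (Suc t)) = insert ?c ?D"
      by simp
    have "finite ?D"
      using IH(1) finite_subset by blast
    then have "card (insert ?c ?D) = Suc t"
      using card_insert_disjoint[OF _ c(2)] IH(2) by metis
    then show ?case
      unfolding D using IH(1) c(1) by blast
  qed simp
  from this[of n] have "dom (array_after alg x n) \<subseteq> {1..n}" "card (dom (array_after alg x n)) = card {1..n}"
    by simp_all
  then show ?thesis
    by (rule card_subset_eq[OF finite_atLeastAtMost])
qed

end

theory Submission imports Defs begin

text \<open>
  The algorithm works in phases that each consume half of the remaining items. In phase \<open>j\<close> the
  unit interval is divided into buckets of width proportional to \<open>2\<^sup>j log n / n\<close>, so that each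
  bucket expects \<open>\<Theta>(log n)\<close> arrivals, and at the start of the phase a contiguous stretch of
  unused cells, sorted by bucket, is handed out so that every bucket owns exactly \<open>c\<close> free cells,
  counting the holes left over from earlier phases. If \<open>q\<close> cells per bucket remain, then a bucket
  expects about \<open>q / 2\<close> arrivals, and \<open>c = 2 q / 3\<close>. By a Chernoff bound every bucket receives
  between \<open>c / 2\<close> and \<open>c\<close> items, with high probability: no bucket overflows, and when
  neighbouring buckets are merged in pairs for the next phase the holes still fit into the new
  capacity.

  Comparing every item with the value for which its cell was first reserved, an item of phase \<open>j\<close>
  is off by at most about the bucket width of phase \<open>j\<close>, which adds up to \<open>O(log n)\<close> per phase,
  and the reserved values increase along the array except for one descent per phase. With
  \<open>O(log n)\<close> phases the cost is \<open>O(log\<^sup>2 n)\<close>.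
\<close>

section \<open>Cost of an array close to a piecewise sorted one\<close>

lemma sorted_concat_replicate:
  fixes g :: "nat \<Rightarrow> nat"
  assumes "mono g"
  shows "sorted (concat (map (\<lambda>b. replicate (f b) (g b)) [0..<m]))"
proof (induction m)
  case (Suc m)
  have "a \<le> g m" if "a \<in> set (concat (map (\<lambda>b. replicate (f b) (g b)) [0..<m]))" for a
    using that assms by (auto simp: mono_def split: if_splits)
  then show ?case using Suc by (auto simp: sorted_append)
qed simp

definition descents :: "nat list \<Rightarrow> nat set" where
  "descents L = {i. Suc i < length L \<and> L ! Suc i < L ! i}"

lemma finite_descents [simp]: "finite (descents L)"
  by (rule finite_subset[of _ "{..<length L}"]) (auto simp: descents_def)

text \<open>A descent of the concatenation lies inside \<open>L\<close>, inside \<open>M\<close>, or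
  at the junction; sortedness excludes the second kind. Each phase appends one sorted stretch, so
  this bounds the descents by the number of phases.\<close>

lemma card_descents_append:
  assumes "sorted M"
  shows "card (descents (L @ M)) \<le> Suc (card (descents L))"
proof -
  have "descents (L @ M) \<subseteq> insert (length L - 1) (descents L)"
  proof
    fix i assume i: "i \<in> descents (L @ M)"
    consider "Suc i < length L" | "Suc i = length L" | "i \<ge> length L" by linarith
    then show "i \<in> insert (length L - 1) (descents L)"
    proof cases
      case 3
      then obtain k where k: "i = length L + k" using le_Suc_ex by blast
      have "Suc i = length L + Suc k" using k by simp
      then have "Suc k < length M" "M ! Suc k < M ! k"
        using i k unfolding descents_def by (auto simp: nth_append)
      then show ?thesis
        using sorted_nth_mono[OF assms, of k "Suc k"] by simp
    qed (use i in \<open>auto simp: descents_def nth_append\<close>)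
  qed
  then have "card (descents (L @ M)) \<le> card (insert (length L - 1) (descents L))"
    by (intro card_mono) auto
  also have "\<dots> \<le> Suc (card (descents L))"
    by (rule card_insert_le_m1) auto
  finally show ?thesis .
qed

section \<open>Cost relative to a reference profile\<close>

lemma array_after_chosen_cell:
  assumes "valid_online_alg n alg" "\<forall>t\<in>{1..n}. x t \<in> {0..1}" "t \<le> n" "s \<in> {1..t}"
  shows "array_after alg x t (chosen_cell alg x s) = Some (x s)"
  using assms(3,4)
proof (induction t)
  case (Suc t)
  have "array_after alg x t (chosen_cell alg x (Suc t)) = None"
    using assms(1)[unfolded valid_online_alg_def, rule_format, of x "Suc t"] assms(2) Suc.prems by simp
  then show ?case
    using Suc by (cases "s = Suc t") auto
qed simp

text \<open>A cell filled earlier is no longer empty, which gives injectivity; surjectivity follows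
  by finiteness. The bijection turns sums over cells into sums over arrival times.\<close>

lemma bij_betw_chosen_cell:
  assumes "valid_online_alg n alg" "\<forall>t\<in>{1..n}. x t \<in> {0..1}"
  shows "bij_betw (chosen_cell alg x) {1..n} {1..n}"
proof -
  have None: "array_after alg x (t - 1) (chosen_cell alg x t) = None"
    and range: "chosen_cell alg x t \<in> {1..n}" if "t \<in> {1..n}" for t
    using assms that unfolding valid_online_alg_def by blast+
  have neq: "chosen_cell alg x s \<noteq> chosen_cell alg x t" if "s \<in> {1..n}" "t \<in> {1..n}" "s < t" for s t
  proof -
    have "t - 1 \<le> n" "s \<in> {1..t - 1}" using that by auto
    then have "array_after alg x (t - 1) (chosen_cell alg x s) = Some (x s)"
      using array_after_chosen_cell[OF assms] by blast
    then show ?thesis using None[OF that(2)] by auto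
  qed
  have "inj_on (chosen_cell alg x) {1..n}"
    using neq by (intro linorder_inj_onI') metis
  moreover from this have "chosen_cell alg x ` {1..n} = {1..n}"
    using range by (intro endo_inj_surj) auto
  ultimately show ?thesis
    by (simp add: bij_betw_def)
qed

text \<open>Off \<open>D\<close> the absolute difference is the increment itself, and on
  \<open>D\<close> it exceeds the increment by at most \<open>2 * M\<close>. The increments
  telescope to at most \<open>M\<close>.\<close>

lemma sum_abs_diff_le_if_few_descents:
  fixes f :: "nat \<Rightarrow> real"
  assumes "\<And>i. 0 \<le> f i" "\<And>i. f i \<le> M" "finite D" "\<And>i. f (Suc i) < f i \<Longrightarrow> i \<in> D"
  shows "(\<Sum>i<m. \<bar>f (Suc i) - f i\<bar>) \<le> M + 2 * M * card D"
proof -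
  have "0 \<le> M" using assms(1,2) order_trans by blast
  have "\<bar>f (Suc i) - f i\<bar> \<le> (f (Suc i) - f i) + (if i \<in> D then 2 * M else 0)" for i
    using assms(1)[of i] assms(1)[of "Suc i"] assms(2)[of i] assms(4)[of i] \<open>0 \<le> M\<close>
    by (auto simp: abs_if not_less)
  then have "(\<Sum>i<m. \<bar>f (Suc i) - f i\<bar>) \<le> (\<Sum>i<m. (f (Suc i) - f i) + (if i \<in> D then 2 * M else 0))"
    by (intro sum_mono) auto
  also have "\<dots> = (f m - f 0) + (\<Sum>i\<in>{..<m} \<inter> D. 2 * M)"
    by (simp add: sum.distrib sum_lessThan_telescope sum.inter_restrict del: sum_constant)
  also have "(\<Sum>i\<in>{..<m} \<inter> D. 2 * M) \<le> 2 * M * card D"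
    using card_mono[of D "{..<m} \<inter> D"] assms(3) \<open>0 \<le> M\<close>
    by (simp add: mult.commute mult_left_mono)
  finally show ?thesis
    using assms(1)[of 0] assms(2)[of m] by linarith
qed

text \<open>Triangle inequality through the profile \<open>f\<close>: the deviation of each cell
  enters at most twice, once for each neighbour. Cells start at 1 and \<open>f\<close> at 0, hence
  the shift by one.\<close>

lemma sorting_cost_le:
  assumes "valid_online_alg n alg" "\<forall>t\<in>{1..n}. x t \<in> {0..1}"
  shows "sorting_cost n alg x \<le>
    (\<Sum>i<n - 1. \<bar>f (Suc i) - f i\<bar>) + 2 * (\<Sum>t = 1..n. \<bar>x t - f (chosen_cell alg x t - 1)\<bar>)"
proof -
  let ?A = "\<lambda>i. the (array_after alg x n i)"
  let ?d = "\<lambda>i. \<bar>?A i - f (i - 1)\<bar>"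
  have "sorting_cost n alg x \<le> (\<Sum>i = 1..<n. \<bar>f i - f (i - 1)\<bar> + (?d (i + 1) + ?d i))"
    unfolding sorting_cost_def by (intro sum_mono) (unfold add_diff_cancel_right', linarith)
  also have "\<dots> = (\<Sum>i = 1..<n. \<bar>f i - f (i - 1)\<bar>) + ((\<Sum>i = 1..<n. ?d (i + 1)) + (\<Sum>i = 1..<n. ?d i))"
    by (simp add: sum.distrib)
  also have "(\<Sum>i = 1..<n. \<bar>f i - f (i - 1)\<bar>) = (\<Sum>i<n - 1. \<bar>f (Suc i) - f i\<bar>)"
    by (rule sum.reindex_bij_witness[of _ Suc "\<lambda>i. i - 1"]) auto
  also have "(\<Sum>i = 1..<n. ?d (i + 1)) = (\<Sum>i = 2..<n + 1. ?d i)"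
    by (rule sum.reindex_bij_witness[of _ "\<lambda>i. i - 1" Suc]) auto
  also have "\<dots> \<le> (\<Sum>i = 1..n. ?d i)"
    by (intro sum_mono2) auto
  also have "(\<Sum>i = 1..<n. ?d i) \<le> (\<Sum>i = 1..n. ?d i)"
    by (intro sum_mono2) auto
  finally have "sorting_cost n alg x \<le> (\<Sum>i<n - 1. \<bar>f (Suc i) - f i\<bar>) + 2 * (\<Sum>i = 1..n. ?d i)"
    by simp
  also have "(\<Sum>i = 1..n. ?d i) = (\<Sum>t = 1..n. ?d (chosen_cell alg x t))"
    using sum.reindex_bij_betw[OF bij_betw_chosen_cell[OF assms], of ?d] by simp
  also have "\<dots> = (\<Sum>t = 1..n. \<bar>x t - f (chosen_cell alg x t - 1)\<bar>)"
    using array_after_chosen_cell[OF assms order_refl] by (intro sum.cong) auto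
  finally show ?thesis .
qed

section \<open>Dyadic rounding and the choice of scale\<close>

lemma abs_diff_less_if_div_eq:
  fixes a b p :: nat
  assumes "a div p = b div p" "0 < p"
  shows "\<bar>real a - real b\<bar> < real p"
proof -
  have "a < b + p" "b < a + p"
    using assms dividend_less_div_times[of p a] dividend_less_div_times[of p b]
      div_times_less_eq_dividend[of a p] div_times_less_eq_dividend[of b p]
    by (metis add_le_cancel_left add.commute order_less_le_trans)+
  then show ?thesis by linarith
qed

text \<open>The truncated subtraction puts \<open>0\<close> into the first grid cell and \<open>1\<close> into the last one.\<close>

definition grid :: "nat \<Rightarrow> real \<Rightarrow> nat" where
  "grid J y = nat \<lceil>2 ^ J * y\<rceil> - 1"

lemma grid_less:
  assumes "y \<le> 1"
  shows "grid J y < 2 ^ J"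
proof -
  have "\<lceil>2 ^ J * y\<rceil> \<le> 2 ^ J"
    using assms by (simp add: ceiling_le_iff)
  then have "nat \<lceil>2 ^ J * y\<rceil> \<le> 2 ^ J"
    by (metis nat_le_iff of_nat_numeral of_nat_power)
  moreover have "(0::nat) < 2 ^ J" by simp
  ultimately show ?thesis unfolding grid_def by linarith
qed

lemma grid_bounds:
  assumes "0 \<le> y"
  shows "real (grid J y) \<le> 2 ^ J * y" "2 ^ J * y \<le> real (grid J y) + 1"
proof -
  have "0 \<le> 2 ^ J * y" using assms by simp
  then have "0 \<le> \<lceil>2 ^ J * y\<rceil>" by linarith
  then show "2 ^ J * y \<le> real (grid J y) + 1"
    unfolding grid_def by linarith
  show "real (grid J y) \<le> 2 ^ J * y"
    unfolding grid_def using \<open>0 \<le> 2 ^ J * y\<close> by linarith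
qed

text \<open>Halve \<open>n\<close> as long as it is at least \<open>2 * r\<close>; the quotient then
  never drops below \<open>r\<close>. The case \<open>J = 0\<close> covers \<open>n\<close> that are
  small from the start.\<close>

lemma exists_scale:
  fixes n r :: nat
  assumes "0 < r"
  shows "\<exists>J. n div 2 ^ J < 2 * r \<and> (J = 0 \<or> r \<le> n div 2 ^ J)"
proof (induction n rule: less_induct)
  case (less n)
  show ?case
  proof (cases "n < 2 * r")
    case False
    then obtain J where J: "n div 2 div 2 ^ J < 2 * r" "J = 0 \<or> r \<le> n div 2 div 2 ^ J"
      using less[of "n div 2"] assms by auto
    have "n div 2 ^ Suc J = n div 2 div 2 ^ J"
      by (simp add: div_mult2_eq)
    then show ?thesis
      using J False by (intro exI[of _ "Suc J"]) auto
  qed (auto intro: exI[of _ 0])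
qed

section \<open>Independent uniform items\<close>

abbreviation (input) unit_uniform :: "real measure" where
  "unit_uniform \<equiv> uniform_measure lborel {0..1}"

lemma prob_space_unit_uniform: "prob_space unit_uniform"
  by (intro prob_space_uniform_measure) auto

lemma product_prob_space_unit_uniform: "product_prob_space (\<lambda>_::nat. unit_uniform)"
  by (intro product_prob_spaceI prob_space_unit_uniform)

lemma measurable_item:
  "t \<in> {1..n} \<Longrightarrow> (\<lambda>x. x t) \<in> borel_measurable (uniform_items n)"
  unfolding uniform_items_def
  using measurable_component_singleton[of t "{1..n}" "\<lambda>_. unit_uniform"]
  by (simp cong: measurable_cong_sets)

lemma borel_measurable_card_hits:
  assumes "T \<subseteq> {1..n}" "B \<in> sets borel"
  shows "(\<lambda>x. real (card {t \<in> T. x t \<in> B})) \<in> borel_measurable (uniform_items n)"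
proof -
  have "finite T" using assms(1) finite_subset by blast
  then have "real (card {t \<in> T. x t \<in> B}) = (\<Sum>t\<in>T. indicator B (x t))" for x :: "nat \<Rightarrow> real"
    by (simp add: indicator_def sum.If_cases Int_def)
  moreover have "(\<lambda>x. indicator B (x t) :: real) \<in> borel_measurable (uniform_items n)" if "t \<in> T" for t
    using that assms by (intro measurable_compose[OF measurable_item]) auto
  ultimately show ?thesis
    by (simp only:) (intro borel_measurable_sum)
qed

text \<open>Positive \<open>l\<close> gives the upper tail, negative \<open>l\<close> the lower tail.\<close>

lemma chernoff_card_hits:
  fixes l a :: real
  assumes T: "T \<subseteq> {1..n}" and B: "B \<in> sets borel"
  shows "measure (uniform_items n)
      {x \<in> space (uniform_items n). l * a \<le> l * card {t \<in> T. x t \<in> B}}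
    \<le> exp (card T * measure unit_uniform B * (exp l - 1) - l * a)"
proof -
  interpret U: prob_space unit_uniform by (rule prob_space_unit_uniform)
  interpret product_prob_space "\<lambda>_::nat. unit_uniform" by (rule product_prob_space_unit_uniform)
  interpret X: prob_space "uniform_items n" by (rule prob_space_uniform_items)
  let ?p = "measure unit_uniform B"
  \<comment> \<open>For an indicator, \<open>exp (l * indicator B y)\<close> is affine in the
    indicator, so independence makes the moment generating function a product of explicit
    factors.\<close>
  define g where "g t y = (if t \<in> T then 1 + (exp l - 1) * indicator B y else 1)" for t :: nat and y :: real
  define F where "F x = exp (l * card {t \<in> T. x t \<in> B})" for x :: "nat \<Rightarrow> real"
  have fin: "finite T" using T finite_subset by blast
  have indB: "integrable unit_uniform (indicator B :: real \<Rightarrow> real)"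
    using B U.emeasure_finite[of B] by (intro integrable_real_indicator) (simp_all add: less_top)
  have int_g: "integrable unit_uniform (g t)" for t
    unfolding g_def using indB by (cases "t \<in> T") simp_all
  have g: "integral\<^sup>L unit_uniform (g t) = (if t \<in> T then 1 + (exp l - 1) * ?p else 1)" for t
    unfolding g_def using indB B by (simp add: U.prob_space)
  have F: "F x = (\<Prod>t\<in>{1..n}. g t (x t))" for x
  proof -
    have "(\<Prod>t\<in>{1..n}. g t (x t)) = (\<Prod>t\<in>T. exp (l * indicator B (x t)))"
      by (rule prod.mono_neutral_cong_right) (use T in \<open>auto simp: g_def indicator_def\<close>)
    also have "\<dots> = exp (\<Sum>t\<in>T. l * indicator B (x t))"
      by (rule exp_sum[OF fin, symmetric])
    also have "(\<Sum>t\<in>T. l * indicator B (x t)) = l * card {t \<in> T. x t \<in> B}"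
      using fin by (simp add: indicator_def sum.If_cases Int_def flip: sum_distrib_left)
    finally show ?thesis by (simp add: F_def)
  qed
  have int_F: "integrable (uniform_items n) F"
    unfolding F uniform_items_def by (intro product_integrable_prod int_g) auto
  have "{x \<in> space (uniform_items n). l * a \<le> l * card {t \<in> T. x t \<in> B}} =
      {x \<in> space (uniform_items n). F x \<ge> exp (l * a)}"
    by (simp add: F_def)
  also have "X.prob \<dots> \<le> X.expectation F / exp (l * a)"
    by (intro integral_Markov_inequality_measure[where A = "{}"] int_F) (auto simp: F_def)
  also have "X.expectation F = (\<Prod>t\<in>{1..n}. integral\<^sup>L unit_uniform (g t))"
    unfolding F uniform_items_def by (intro product_integral_prod int_g) auto
  also have "\<dots> = (1 + (exp l - 1) * ?p) ^ card T"
  proof -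
    have "(\<Prod>t\<in>{1..n}. integral\<^sup>L unit_uniform (g t)) = (\<Prod>t\<in>T. 1 + (exp l - 1) * ?p)"
      unfolding g by (rule prod.mono_neutral_cong_right) (use T in auto)
    then show ?thesis by simp
  qed
  \<comment> \<open>\<open>1 + u \<le> exp u\<close>; raising it to a power needs a nonnegative left
    side, which holds because \<open>?p \<le> 1\<close>.\<close>
  also have "\<dots> \<le> exp ((exp l - 1) * ?p) ^ card T"
  proof (rule power_mono)
    have "0 \<le> (1 - ?p) + exp l * ?p" by simp
    then show "0 \<le> 1 + (exp l - 1) * ?p" by (simp add: algebra_simps)
  qed simp
  also have "\<dots> = exp (card T * ?p * (exp l - 1))"
    by (simp add: mult_ac flip: exp_of_nat_mult)
  finally show ?thesis
    by (simp add: exp_diff divide_right_mono)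
qed

section \<open>Grid buckets as subintervals of equal probability\<close>

lemma grid_borel [measurable]: "grid J \<in> borel \<rightarrow>\<^sub>M count_space UNIV"
  unfolding grid_def by measurable

lemma grid_bucket_real:
  fixes p :: nat
  assumes "0 \<le> y" "grid J y div p = b" "2 ^ J = K * real p" "0 < p"
  shows "real b \<le> K * y" "K * y \<le> real b + 1"
proof -
  have "b * p \<le> grid J y" "grid J y + 1 \<le> (b + 1) * p"
    using assms(2,4) div_times_less_eq_dividend[of "grid J y" p] dividend_less_div_times[of p "grid J y"]
    by auto
  then have "real (b * p) \<le> real (grid J y)" "real (grid J y + 1) \<le> real ((b + 1) * p)"
    unfolding of_nat_le_iff by blast+
  moreover have "K * y * p = 2 ^ J * y"
    by (simp add: assms(3))
  ultimately have "real b * p \<le> K * y * p" "K * y * p \<le> (real b + 1) * p"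
    using grid_bounds[OF assms(1), of J] unfolding of_nat_mult of_nat_add of_nat_1 by linarith+
  then show "real b \<le> K * y" "K * y \<le> real b + 1"
    using assms(4) by simp_all
qed

text \<open>A partial converse of \<open>grid_bucket_real\<close>: strict inequalities avoid the
  endpoints, whose bucket depends on the rounding convention.\<close>

lemma grid_bucket_if_real:
  fixes p :: nat
  assumes "0 \<le> y" "real b < K * y" "K * y < real b + 1" "2 ^ J = K * real p" "0 < p"
  shows "grid J y div p = b"
proof (rule div_nat_eqI)
  have "real b * p < K * y * p" "K * y * p < (real b + 1) * p"
    using assms by (simp_all add: mult_strict_right_mono)
  then have "real b * p < real (grid J y) + 1" "real (grid J y) < (real b + 1) * p"
    using grid_bounds[OF assms(1), of J] unfolding assms(4) by (simp_all add: algebra_simps)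
  then have "real (b * p) < real (grid J y + 1)" "real (grid J y) < real ((b + 1) * p)"
    by (simp_all add: algebra_simps)
  then have "b * p < grid J y + 1" "grid J y < (b + 1) * p"
    unfolding of_nat_less_iff by blast+
  then show "p * b \<le> grid J y" "grid J y < p * Suc b"
    by (simp_all add: mult.commute)
qed

text \<open>Within the unit interval the bucket lies between an open and a closed interval with the
  same endpoints, so both have the same length.\<close>

lemma measure_grid_bucket:
  assumes "j \<le> J" "b < 2 ^ (J - j)"
  shows "measure unit_uniform {y. grid J y div 2 ^ j = b} = 1 / 2 ^ (J - j)"
proof -
  define K :: real where "K = 2 ^ (J - j)"
  let ?B = "{y. grid J y div 2 ^ j = b}"
  have K: "(2::real) ^ J = K * real (2 ^ j)" "0 < K"
    using assms(1) by (simp_all add: K_def flip: power_add)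
  have "real (b + 1) \<le> real (2 ^ (J - j))"
    using assms(2) unfolding of_nat_le_iff by simp
  then have b: "real b + 1 \<le> K"
    by (simp add: K_def)
  have B: "?B \<in> sets borel"
    by measurable
  have upper: "{0..1} \<inter> ?B \<subseteq> {b / K..(b + 1) / K}"
    using grid_bucket_real[OF _ _ K(1)] K(2)
    by (fastforce simp: pos_divide_le_eq pos_le_divide_eq mult.commute[of K] add.commute)
  have lower: "{b / K<..<(b + 1) / K} \<subseteq> {0..1} \<inter> ?B"
  proof
    fix y :: real assume "y \<in> {b / K<..<(b + 1) / K}"
    then have y: "real b < K * y" "K * y < real b + 1"
      using K(2) by (auto simp: pos_divide_less_eq pos_less_divide_eq mult.commute)
    have "0 < K * y" using y by linarith
    then have "0 < y" using K(2) by (simp add: zero_less_mult_iff)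
    moreover have "K * y < K * 1" using y b by linarith
    then have "y < 1" using K(2) by simp
    moreover have "grid J y div 2 ^ j = b"
      using grid_bucket_if_real[OF _ y K(1)] \<open>0 < y\<close> by simp
    ultimately show "y \<in> {0..1} \<inter> ?B" by simp
  qed
  have "{0..1} \<inter> ?B \<in> fmeasurable lborel"
    by (rule fmeasurableI2[of "{0..1}"]) (use B in \<open>auto intro!: fmeasurableI\<close>)
  have len: "(b + 1) / K - b / K = 1 / K" "b / K \<le> (b + 1) / K"
    using K(2) by (simp_all add: divide_right_mono flip: diff_divide_distrib)
  have "measure lborel ({0..1} \<inter> ?B) \<le> measure lborel {b / K..(b + 1) / K}"
    by (rule measure_mono_fmeasurable[OF upper])
      (use B in \<open>auto intro!: fmeasurableI simp: emeasure_lborel_Icc_eq\<close>)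
  moreover have "measure lborel {b / K<..<(b + 1) / K} \<le> measure lborel ({0..1} \<inter> ?B)"
    by (rule measure_mono_fmeasurable[OF lower]) (simp, fact)
  ultimately have "measure lborel ({0..1} \<inter> ?B) = 1 / K"
    using len by simp
  then show ?thesis
    using B by (simp add: measure_uniform_measure K_def)
qed

lemma measurable_list_of_items:
  assumes "\<And>i. i < m \<Longrightarrow> f i \<in> M \<rightarrow>\<^sub>M count_space UNIV"
  shows "(\<lambda>x. map (\<lambda>i. f i x) [0..<m]) \<in> M \<rightarrow>\<^sub>M count_space (UNIV :: 'a :: countable list set)"
  using assms
proof (induction m)
  case (Suc m)
  have "(\<lambda>x. map (\<lambda>i. f i x) [0..<m]) \<in> M \<rightarrow>\<^sub>M count_space UNIV"
    by (rule Suc.IH) (use Suc.prems in simp)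
  moreover have "f m \<in> M \<rightarrow>\<^sub>M count_space UNIV"
    using Suc.prems by simp
  ultimately have "(\<lambda>x. map (\<lambda>i. f i x) [0..<m] @ [f m x]) \<in> M \<rightarrow>\<^sub>M count_space UNIV"
    by measurable
  then show ?case by simp
qed simp

lemma AE_items_in_unit_interval: "AE x in uniform_items n. \<forall>t\<in>{1..n}. x t \<in> {0..1}"
proof (rule AE_finite_allI)
  fix t assume "t \<in> {1..n}"
  moreover have "AE y in unit_uniform. y \<in> {0..1}"
    by (rule AE_uniform_measureI) auto
  ultimately show "AE x in uniform_items n. x t \<in> {0..1}"
    unfolding uniform_items_def by (intro AE_PiM_component prob_space_unit_uniform)
qed simp

section \<open>The placement algorithm\<close>

text \<open>
  Items and cells are numbered from \<open>0\<close> here, and items are rounded to a grid of width \<open>1 / 2\<^sup>J\<close>, so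
  that \<open>w t < 2\<^sup>J\<close> stands for the \<open>t\<close>-th item. The bucket of a grid point \<open>a\<close> in phase \<open>j\<close> is
  \<open>a div 2\<^sup>j\<close>. A list \<open>L\<close> records for the first \<open>length L\<close> cells the grid point for which they were
  reserved; \<open>S\<close> is the set of occupied cells.
\<close>

locale bucket_placement =
  fixes n J c :: nat
begin

text \<open>Labels are grid points and the bucket is read off at the current scale, so holes left by
  finer phases pass to the merged bucket without relabelling.\<close>

definition free :: "nat list \<Rightarrow> nat set \<Rightarrow> nat \<Rightarrow> nat \<Rightarrow> nat set" where
  "free L S j b = {i. i < length L \<and> i \<notin> S \<and> L ! i div 2 ^ j = b}"

definition fresh :: "nat list \<Rightarrow> nat set \<Rightarrow> nat \<Rightarrow> nat list" where
  "fresh L S j = concat (map (\<lambda>b. replicate (c - card (free L S j b)) (b * 2 ^ j)) [0..<2 ^ (J - j)])"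

text \<open>Chosen so that exactly \<open>n div 2 ^ j\<close> items are still to come when phase
  \<open>j\<close> begins.\<close>

definition phase_start :: "nat \<Rightarrow> nat" where
  "phase_start j = n - n div 2 ^ j"

definition phase :: "nat \<Rightarrow> nat" where
  "phase t = (LEAST j. t < phase_start (Suc j))"

definition extend :: "nat \<Rightarrow> nat list \<Rightarrow> nat set \<Rightarrow> nat list" where
  "extend t L S =
     (if phase t < J \<and> t = phase_start (phase t) then L @ fresh L S (phase t) else L)"

text \<open>
  The intersection with \<^term>\<open>{..<n}\<close> and the fallback matter only on unbalanced inputs and after
  phase \<open>J\<close> has begun; they make the algorithm valid on every input.
\<close>

definition pick :: "nat \<Rightarrow> nat list \<Rightarrow> nat set \<Rightarrow> nat \<Rightarrow> nat" where
  "pick t L S a =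
     (let F = free L S (phase t) (a div 2 ^ phase t) \<inter> {..<n}
      in if F \<noteq> {} then Min F else (LEAST i. i \<notin> S))"

primrec state :: "(nat \<Rightarrow> nat) \<Rightarrow> nat \<Rightarrow> nat list \<times> nat set" where
  "state w 0 = ([], {})"
| "state w (Suc t) =
     (let L = extend t (fst (state w t)) (snd (state w t)); S = snd (state w t)
      in (L, insert (pick t L S (w t)) S))"

definition occupied :: "(nat \<Rightarrow> nat) \<Rightarrow> nat \<Rightarrow> nat set" where
  "occupied w t = snd (state w t)"

definition labels :: "(nat \<Rightarrow> nat) \<Rightarrow> nat \<Rightarrow> nat list" where
  "labels w t = fst (state w t)"

definition cell :: "(nat \<Rightarrow> nat) \<Rightarrow> nat \<Rightarrow> nat" where
  "cell w t = pick t (labels w (Suc t)) (occupied w t) (w t)"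

section \<open>Elementary properties of a run\<close>

lemma labels_0 [simp]: "labels w 0 = []"
  and labels_Suc: "labels w (Suc t) = extend t (labels w t) (occupied w t)"
  and occupied_0 [simp]: "occupied w 0 = {}"
  and occupied_Suc: "occupied w (Suc t) = insert (cell w t) (occupied w t)"
  by (simp_all add: labels_def occupied_def cell_def Let_def)

lemma finite_occupied [simp]: "finite (occupied w t)"
  by (induction t) (simp_all add: occupied_Suc)

lemma finite_free [simp]: "finite (free L S j b)"
  unfolding free_def by simp

lemma state_cong: "(\<And>i. i < t \<Longrightarrow> w i = v i) \<Longrightarrow> state w t = state v t"
  by (induction t) (simp_all add: Let_def)

text \<open>This is the online property: the choice at time \<open>t\<close> sees only the items
  with index at most \<open>t\<close>.\<close>

lemma cell_cong:
  assumes "\<And>i. i \<le> t \<Longrightarrow> w i = v i"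
  shows "cell w t = cell v t"
proof -
  have "state w t = state v t" "state w (Suc t) = state v (Suc t)"
    by (rule state_cong, use assms in simp)+
  then show ?thesis
    using assms[of t] by (simp add: cell_def labels_def occupied_def)
qed

lemma cell_valid:
  assumes "t < n"
  shows "cell w t < n \<and> cell w t \<notin> occupied w t \<and> occupied w t \<subseteq> {..<n} \<and> card (occupied w t) = t"
  using assms
proof (induction t)
  \<comment> \<open>The claims on \<open>cell\<close> follow from those on \<open>occupied\<close>
    at the same time, so only the latter need to be carried from \<open>t\<close> to
    \<open>Suc t\<close>.\<close>
  have step: "cell w t < n \<and> cell w t \<notin> occupied w t"
    if "occupied w t \<subseteq> {..<n}" "card (occupied w t) = t" "t < n" for t
  proof -
    let ?S = "occupied w t"
    let ?F = "free (labels w (Suc t)) ?S (phase t) (w t div 2 ^ phase t) \<inter> {..<n}"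
    show ?thesis
    proof (cases "?F = {}")
      case True
      have "\<not> {..<n} \<subseteq> ?S"
        using that by (metis card_lessThan finite_occupied card_mono not_less)
      then obtain i where i: "i < n" "i \<notin> ?S" by auto
      have "cell w t = (LEAST i. i \<notin> ?S)"
        using True by (simp add: cell_def pick_def Let_def)
      then show ?thesis
        using LeastI[of "\<lambda>i. i \<notin> ?S" i] Least_le[of "\<lambda>i. i \<notin> ?S" i] i by auto
    next
      case False
      then have "cell w t = Min ?F"
        by (simp add: cell_def pick_def Let_def)
      moreover have "Min ?F \<in> ?F"
        using False by (intro Min_in) auto
      ultimately show ?thesis
        by (auto simp: free_def)
    qed
  qed
  {
    case 0
    then show ?case using step[of 0] by simp
  next
  case (Suc t)
  then have IH: "cell w t < n" "cell w t \<notin> occupied w t" "occupied w t \<subseteq> {..<n}" "card (occupied w t) = t"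
    by auto
  then have "occupied w (Suc t) \<subseteq> {..<n}" "card (occupied w (Suc t)) = Suc t"
    by (auto simp: occupied_Suc)
  then show ?case using step[of "Suc t"] Suc.prems by blast
  }
qed

text \<open>Labels are only ever appended, so the label seen when a cell is filled is still its
  label at the end.\<close>

lemma labels_prefix: "t \<le> t' \<Longrightarrow> \<exists>zs. labels w t' = labels w t @ zs"
proof (induction t' rule: dec_induct)
  case (step m)
  then show ?case by (auto simp: labels_Suc extend_def)
qed simp

section \<open>Phase boundaries\<close>

lemma phase_start_mono: "i \<le> j \<Longrightarrow> phase_start i \<le> phase_start j"
  unfolding phase_start_def by (intro diff_le_mono2 div_le_mono2) auto

lemma phase_start_le: "phase_start j \<le> n"
  unfolding phase_start_def by simp

lemma phase_start_0 [simp]: "phase_start 0 = 0"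
  unfolding phase_start_def by simp

lemma phase_eq:
  assumes "phase_start j \<le> t" "t < phase_start (Suc j)"
  shows "phase t = j"
  unfolding phase_def
proof (rule Least_equality)
  fix i assume "t < phase_start (Suc i)"
  then show "j \<le> i"
    using assms(1) phase_start_mono[of "Suc i" j] by (meson not_less not_less_eq_eq order_trans leD)
qed (fact assms)

text \<open>\<open>n div 2 ^ j\<close> is positive here, and halving lowers it strictly. A nonempty
  phase is needed because its first item triggers the extension.\<close>

lemma phase_less_Suc:
  assumes "j < J" "2 ^ J \<le> n"
  shows "phase_start j < phase_start (Suc j)"
proof -
  have "(2::nat) ^ j \<le> 2 ^ J" using assms by simp
  also note assms(2)
  finally have "0 < n div 2 ^ j" by (simp add: div_greater_zero_iff)
  moreover have "n div 2 ^ Suc j = n div 2 ^ j div 2" 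
    by (metis div_mult2_eq power_Suc2)
  moreover have "n div 2 ^ j \<le> n" by simp
  ultimately show ?thesis
    unfolding phase_start_def by linarith
qed

section \<open>Counting the free cells of a bucket\<close>

lemma length_filter_fresh:
  assumes "b < 2 ^ (J - j)"
  shows "length (filter (\<lambda>a. a div 2 ^ j = b) (fresh L S j)) = c - card (free L S j b)"
proof -
  have "length (filter (\<lambda>a. a div 2 ^ j = b) (fresh L S j))
    = (\<Sum>b'\<leftarrow>[0..<2 ^ (J - j)]. if b' = b then c - card (free L S j b) else 0)"
    unfolding fresh_def filter_concat length_concat map_map
    by (intro arg_cong[of _ _ sum_list] map_cong) (auto simp: o_def)
  also have "\<dots> = c - card (free L S j b)"
    using assms by (simp add: sum_list_distinct_conv_sum_set)
  finally show ?thesis .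
qed

text \<open>All occupied cells lie within \<open>L\<close>, so every appended cell is still
  empty.\<close>

lemma card_free_append:
  assumes "S \<subseteq> {..<length L}"
  shows "card (free (L @ M) S j b) = card (free L S j b) + length (filter (\<lambda>a. a div 2 ^ j = b) M)"
proof -
  let ?M = "{i. i < length M \<and> M ! i div 2 ^ j = b}"
  have "free (L @ M) S j b = free L S j b \<union> (\<lambda>i. length L + i) ` ?M"
  proof (rule set_eqI)
    fix i
    show "i \<in> free (L @ M) S j b \<longleftrightarrow> i \<in> free L S j b \<union> (\<lambda>i. length L + i) ` ?M"
    proof (cases "i < length L")
      case False
      then obtain k where "i = length L + k" using le_Suc_ex by (metis not_less)
      then show ?thesis using assms by (auto simp: free_def)
    qed (auto simp: free_def nth_append)
  qed
  moreover have "free L S j b \<inter> (\<lambda>i. length L + i) ` ?M = {}"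
    by (auto simp: free_def)
  ultimately have "card (free (L @ M) S j b) = card (free L S j b) + card ((\<lambda>i. length L + i) ` ?M)"
    by (simp add: card_Un_disjoint)
  also have "card ((\<lambda>i. length L + i) ` ?M) = card ?M"
    by (intro card_image) (auto simp: inj_on_def)
  finally show ?thesis
    by (simp add: length_filter_conv_card)
qed

text \<open>The bound by \<open>c\<close> keeps the subtraction in \<open>fresh\<close> from
  truncating, so topping up reaches \<open>c\<close> exactly.\<close>

lemma card_free_fresh:
  assumes "S \<subseteq> {..<length L}" "b < 2 ^ (J - j)" "card (free L S j b) \<le> c"
  shows "card (free (L @ fresh L S j) S j b) = c"
  using card_free_append[OF assms(1)] length_filter_fresh[OF assms(2)] assms(3) by simp

lemma card_free_Suc:
  "card (free L S (Suc j) b) = card (free L S j (2 * b)) + card (free L S j (2 * b + 1))"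
proof -
  have *: "a div 2 ^ Suc j = b \<longleftrightarrow> a div 2 ^ j = 2 * b \<or> a div 2 ^ j = 2 * b + 1" for a :: nat
  proof -
    have "a div 2 ^ Suc j = a div 2 ^ j div 2" by (metis div_mult2_eq power_Suc2)
    then show ?thesis by auto
  qed
  have "free L S (Suc j) b = free L S j (2 * b) \<union> free L S j (2 * b + 1)"
    unfolding free_def * by auto
  moreover have "free L S j (2 * b) \<inter> free L S j (2 * b + 1) = {}"
    by (auto simp: free_def)
  ultimately show ?thesis
    by (simp add: card_Un_disjoint)
qed

lemma card_free_insert:
  assumes "i \<in> free L S j a"
  shows "card (free L (insert i S) j b) = card (free L S j b) - (if b = a then 1 else 0)"
proof -
  have "free L (insert i S) j b = free L S j b - {i}"
    by (auto simp: free_def)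
  then show ?thesis
    using assms by (auto simp: card_Diff_singleton_if free_def)
qed

lemma fresh_bounds:
  assumes "a \<in> set (fresh L S j)" "j \<le> J"
  shows "a < 2 ^ J"
proof -
  obtain b where b: "b < 2 ^ (J - j)" "a = b * 2 ^ j"
    using assms(1) by (auto simp: fresh_def split: if_splits)
  then have "a < 2 ^ (J - j) * 2 ^ j" by simp
  then show ?thesis using assms(2) by (simp flip: power_add)
qed

lemma sorted_fresh: "sorted (fresh L S j)"
  unfolding fresh_def by (intro sorted_concat_replicate) (simp add: mono_def)

section \<open>Balance and the invariant at phase boundaries\<close>

definition arrivals :: "(nat \<Rightarrow> nat) \<Rightarrow> nat \<Rightarrow> nat \<Rightarrow> nat \<Rightarrow> nat" where
  "arrivals w j b t = card {s \<in> {phase_start j..<t}. w s div 2 ^ j = b}"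

definition balanced :: "(nat \<Rightarrow> nat) \<Rightarrow> bool" where
  "balanced w \<longleftrightarrow> (\<forall>j<J. \<forall>b<2 ^ (J - j).
     arrivals w j b (phase_start (Suc j)) \<le> c \<and> c \<le> 2 * arrivals w j b (phase_start (Suc j)))"

text \<open>This describes the moment before phase \<open>j\<close> appends its fresh cells, yet the
  holes are already counted at scale \<open>j\<close>. At most \<open>j\<close> stretches have been
  appended by then, hence the bound on descents.\<close>

definition phase_inv :: "(nat \<Rightarrow> nat) \<Rightarrow> nat \<Rightarrow> bool" where
  "phase_inv w j \<longleftrightarrow>
     (let L = labels w (phase_start j); S = occupied w (phase_start j)
      in S \<subseteq> {..<length L} \<and> set L \<subseteq> {..<2 ^ J} \<and> length L \<le> n \<and> card (descents L) \<le> j \<and>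
         (\<forall>b<2 ^ (J - j). card (free L S j b) \<le> c))"

lemma arrivals_mono: "t \<le> t' \<Longrightarrow> arrivals w j b t \<le> arrivals w j b t'"
  unfolding arrivals_def by (intro card_mono) auto

lemma arrivals_Suc:
  assumes "phase_start j \<le> t"
  shows "arrivals w j b (Suc t) = arrivals w j b t + (if w t div 2 ^ j = b then 1 else 0)"
proof -
  have "{s \<in> {phase_start j..<Suc t}. w s div 2 ^ j = b} =
     {s \<in> {phase_start j..<t}. w s div 2 ^ j = b} \<union> (if w t div 2 ^ j = b then {t} else {})"
    using assms by (auto simp: less_Suc_eq)
  then show ?thesis
    unfolding arrivals_def by (auto simp: card_insert_if)
qed

text \<open>Every cell of \<open>L\<close> is occupied or free in one of the
  \<open>2 ^ (J - j)\<close> buckets. There are \<open>n - n div 2 ^ j\<close> of the first kind and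
  at most \<open>2 ^ (J - j) * c \<le> n div 2 ^ j\<close> of the second.\<close>

lemma length_labels_le:
  assumes "S \<subseteq> {..<length L}" "set L \<subseteq> {..<2 ^ J}" "j \<le> J"
    and "\<forall>b<2 ^ (J - j). card (free L S j b) = c" "card S = phase_start j" "c \<le> n div 2 ^ J"
  shows "length L \<le> n"
proof -
  have fin: "finite S" using assms(1) finite_subset by blast
  have "{..<length L} \<subseteq> S \<union> (\<Union>b<2 ^ (J - j). free L S j b)"
  proof
    fix i assume i: "i \<in> {..<length L}"
    then have "L ! i < 2 ^ (J - j) * 2 ^ j"
      using assms(2,3) nth_mem by (fastforce simp flip: power_add)
    then have "L ! i div 2 ^ j < 2 ^ (J - j)"
      by (simp add: less_mult_imp_div_less)
    then show "i \<in> S \<union> (\<Union>b<2 ^ (J - j). free L S j b)"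
      using i by (auto simp: free_def)
  qed
  then have "length L \<le> card (S \<union> (\<Union>b<2 ^ (J - j). free L S j b))"
    using card_mono[of "S \<union> (\<Union>b<2 ^ (J - j). free L S j b)" "{..<length L}"] fin by simp
  also have "\<dots> \<le> card S + card (\<Union>b<2 ^ (J - j). free L S j b)"
    by (rule card_Un_le)
  also have "card (\<Union>b<2 ^ (J - j). free L S j b) \<le> (\<Sum>b<2 ^ (J - j). card (free L S j b))"
    by (rule card_UN_le) simp
  also have "\<dots> = 2 ^ (J - j) * c"
    using assms(4) by simp
  also have "\<dots> \<le> n div 2 ^ j"
  proof -
    have "n div 2 ^ J = n div 2 ^ j div 2 ^ (J - j)"
      using assms(3) by (simp flip: div_mult2_eq power_add)
    then have "2 ^ (J - j) * c \<le> 2 ^ (J - j) * (n div 2 ^ j div 2 ^ (J - j))"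
      using assms(6) by simp
    then show ?thesis
      by (meson order_trans times_div_less_eq_dividend)
  qed
  finally show ?thesis
    using assms(5) phase_start_le[of j] unfolding phase_start_def
    by (metis add_le_cancel_left le_add_diff_inverse2 div_le_dividend)
qed

text \<open>During the phase the labels stay fixed and each bucket loses one free cell per arrival,
  starting from \<open>c\<close>. The upper half of balance keeps a free cell available; the lower
  half restores the invariant after buckets are merged.\<close>

lemma phase_step:
  assumes bal: "balanced w" and range: "\<And>t. t < n \<Longrightarrow> w t < 2 ^ J"
    and j: "j < J" and n: "2 ^ J \<le> n" and c: "c \<le> n div 2 ^ J" and inv: "phase_inv w j"
  shows "phase_inv w (Suc j)"
    and "\<And>t. phase_start j \<le> t \<Longrightarrow> t < phase_start (Suc j) \<Longrightarrow>
           cell w t \<in> free (labels w (Suc t)) (occupied w t) j (w t div 2 ^ j)"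
proof -
  let ?s = "phase_start j" and ?e = "phase_start (Suc j)"
  let ?L0 = "labels w ?s" and ?S0 = "occupied w ?s"
  define L where "L = labels w (Suc ?s)"
  have se: "?s < ?e" using phase_less_Suc j n by blast
  have en: "?e \<le> n" by (rule phase_start_le)
  have ph: "phase t = j" if "?s \<le> t" "t < ?e" for t
    using phase_eq that by blast
  have L: "L = ?L0 @ fresh ?L0 ?S0 j"
    unfolding L_def labels_Suc extend_def using ph[of ?s] se j by simp
  have inv0: "?S0 \<subseteq> {..<length ?L0}" "set ?L0 \<subseteq> {..<2 ^ J}" "card (descents ?L0) \<le> j"
    "\<And>b. b < 2 ^ (J - j) \<Longrightarrow> card (free ?L0 ?S0 j b) \<le> c"
    using inv unfolding phase_inv_def Let_def by auto
  have free0: "\<forall>b<2 ^ (J - j). card (free L ?S0 j b) = c"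
    unfolding L using card_free_fresh inv0 by blast
  have S0: "?S0 \<subseteq> {..<length L}"
    using inv0(1) unfolding L by auto
  have setL: "set L \<subseteq> {..<2 ^ J}"
    using inv0(2) fresh_bounds j unfolding L by fastforce
  have lenL: "length L \<le> n"
    using length_labels_le[OF S0 setL _ free0 _ c] cell_valid[of ?s w] j se en by simp
  have arr: "arrivals w j b t \<le> c" if "t \<le> ?e" "b < 2 ^ (J - j)" for b t
    using arrivals_mono[OF that(1), of w j b] bal j that(2) unfolding balanced_def
    by (meson order_trans)
  have main: "labels w (Suc t) = L \<and> occupied w t \<subseteq> {..<length L} \<and>
      (\<forall>b<2 ^ (J - j). card (free L (occupied w t) j b) = c - arrivals w j b t) \<and>
      cell w t \<in> free L (occupied w t) j (w t div 2 ^ j)"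
    if "?s \<le> t" "t < ?e" for t
    using that
  proof (induction t rule: dec_induct)
    have picks_free: "cell w t \<in> free L (occupied w t) j (w t div 2 ^ j)"
      if t: "?s \<le> t" "t < ?e" and "labels w (Suc t) = L"
        and fr: "\<forall>b<2 ^ (J - j). card (free L (occupied w t) j b) = c - arrivals w j b t" for t
    proof -
      let ?b = "w t div 2 ^ j"
      let ?F = "free L (occupied w t) j ?b"
      have "w t < 2 ^ (J - j) * 2 ^ j"
        using range[of t] t en j by (simp flip: power_add)
      then have b: "?b < 2 ^ (J - j)"
        by (simp add: less_mult_imp_div_less)
      \<comment> \<open>Strict, because the item being placed at time \<open>t\<close> counts among
        the at most \<open>c\<close> arrivals.\<close>
      have "arrivals w j ?b t < c"
        using arr[of "Suc t" ?b] arrivals_Suc[of j t w ?b] t b by simp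
      then have "?F \<noteq> {}"
        using fr b by (metis card.empty diff_is_0_eq not_less)
      moreover have "?F \<inter> {..<n} = ?F"
        using lenL by (auto simp: free_def)
      ultimately have "cell w t = Min ?F"
        using that ph[of t] by (simp add: cell_def pick_def Let_def)
      then show ?thesis
        using \<open>?F \<noteq> {}\<close> Min_in finite_free by metis
    qed
    {
      case base
      have "\<forall>b<2 ^ (J - j). card (free L ?S0 j b) = c - arrivals w j b ?s"
        using free0 by (simp add: arrivals_def)
      with picks_free[of ?s] se S0 show ?case by (simp add: L_def)
    next
      case (step t)
      note IH = step.IH[OF Suc_lessD[OF step.prems]]
      have lab: "labels w (Suc (Suc t)) = L"
        using IH ph[of "Suc t"] step by (simp add: labels_Suc[of w "Suc t"] extend_def)
      have occ: "occupied w (Suc t) \<subseteq> {..<length L}"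
        using IH by (auto simp: occupied_Suc free_def)
      have fr: "\<forall>b<2 ^ (J - j). card (free L (occupied w (Suc t)) j b) = c - arrivals w j b (Suc t)"
      proof (intro allI impI)
        fix b :: nat assume "b < 2 ^ (J - j)"
        then show "card (free L (occupied w (Suc t)) j b) = c - arrivals w j b (Suc t)"
          using IH card_free_insert[of "cell w t" L "occupied w t" j "w t div 2 ^ j" b]
            arrivals_Suc[of j t w b] step.hyps by (auto simp: occupied_Suc)
      qed
      show ?case
        using lab occ fr picks_free[of "Suc t"] step by auto
    }
  qed
  then show "\<And>t. ?s \<le> t \<Longrightarrow> t < ?e \<Longrightarrow> cell w t \<in> free (labels w (Suc t)) (occupied w t) j (w t div 2 ^ j)"
    by metis
  \<comment> \<open>\<open>main\<close> stops before \<open>?e\<close>, so the effect of the last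
    item of the phase is added separately.\<close>
  obtain u where u: "?e = Suc u" "?s \<le> u" "u < ?e"
    using se by (metis lessE less_imp_le_nat less_Suc_eq_le lessI)
  note M = main[OF u(2,3)]
  have fr: "card (free L (occupied w ?e) j b) = c - arrivals w j b ?e" if "b < 2 ^ (J - j)" for b
    using M card_free_insert[of "cell w u" L "occupied w u" j "w u div 2 ^ j" b] that
      arrivals_Suc[of j u w b] u by (auto simp: occupied_Suc)
  \<comment> \<open>Each of the two merged buckets keeps at most \<open>c / 2\<close> holes.\<close>
  have "card (free L (occupied w ?e) (Suc j) b) \<le> c" if "b < 2 ^ (J - Suc j)" for b
  proof -
    have "J - j = Suc (J - Suc j)" using j by simp
    then have b: "2 * b < 2 ^ (J - j)" "2 * b + 1 < 2 ^ (J - j)" using that by auto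
    then have "c \<le> 2 * arrivals w j (2 * b) ?e" "c \<le> 2 * arrivals w j (2 * b + 1) ?e"
      using bal j unfolding balanced_def by auto
    then show ?thesis
      unfolding card_free_Suc using fr b by simp
  qed
  moreover have "card (descents L) \<le> Suc j"
    unfolding L using card_descents_append[OF sorted_fresh, of ?L0] inv0(3) by (meson Suc_le_mono order_trans)
  moreover have "occupied w ?e \<subseteq> {..<length L}"
    unfolding u(1) using M by (auto simp: occupied_Suc free_def)
  moreover have "labels w ?e = L" using M u by simp
  ultimately show "phase_inv w (Suc j)"
    using setL lenL unfolding phase_inv_def Let_def by simp
qed

lemma phase_inv_balanced:
  assumes "balanced w" "\<And>t. t < n \<Longrightarrow> w t < 2 ^ J" "2 ^ J \<le> n" "c \<le> n div 2 ^ J" "j \<le> J"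
  shows "phase_inv w j"
  using assms(5)
proof (induction j)
  case 0
  then show ?case by (simp add: phase_inv_def free_def descents_def)
next
  case (Suc j)
  then show ?case using phase_step(1)[OF assms(1,2) _ assms(3,4)] by simp
qed

text \<open>Extensions happen only at starts of phases below \<open>J\<close>, and all of these
  precede \<open>phase_start J\<close>.\<close>

lemma labels_final:
  assumes "phase_start J \<le> t" "2 ^ J \<le> n"
  shows "labels w t = labels w (phase_start J)"
  using assms(1)
proof (induction t rule: dec_induct)
  case (step t)
  have "extend t L S = L" for L S
  proof (rule ccontr)
    assume "extend t L S \<noteq> L"
    then have "phase t < J" "t = phase_start (phase t)"
      by (auto simp: extend_def split: if_splits)
    moreover from this have "phase_start (phase t) < phase_start J"
      using phase_less_Suc[of "phase t"] phase_start_mono[of "Suc (phase t)" J] assms(2) by simp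
    ultimately show False using step.hyps by simp
  qed
  then show ?case using step by (simp add: labels_Suc)
qed simp

subsection \<open>Cost on balanced inputs\<close>

text \<open>Indices beyond the history give unspecified values of \<open>h ! i\<close>, but by
  \<open>cell_cong\<close> the chosen cell does not depend on them.\<close>

definition alg :: online_alg where
  "alg h = Suc (cell (\<lambda>i. grid J (h ! i)) (length h - 1))"

lemma chosen_cell_alg: "chosen_cell alg x (Suc t) = Suc (cell (\<lambda>i. grid J (x (Suc i))) t)"
proof -
  have "cell (\<lambda>i. grid J (map x [1..<Suc (Suc t)] ! i)) t = cell (\<lambda>i. grid J (x (Suc i))) t"
    by (rule cell_cong) (simp add: nth_append nth_Cons' del: upt_Suc)
  then show ?thesis
    unfolding chosen_cell_def alg_def by (simp del: upt_Suc)
qed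

lemma dom_array_after_alg:
  "dom (array_after alg x t) = Suc ` occupied (\<lambda>i. grid J (x (Suc i))) t"
proof (induction t)
  case (Suc t)
  have "dom (array_after alg x (Suc t)) = insert (chosen_cell alg x (Suc t)) (dom (array_after alg x t))"
    by simp
  then show ?case
    by (simp only: Suc chosen_cell_alg occupied_Suc image_insert)
qed simp

lemma valid_alg: "valid_online_alg n alg"
  unfolding valid_online_alg_def
proof (intro allI impI ballI)
  fix x :: "nat \<Rightarrow> real" and t assume "t \<in> {1..n}"
  then obtain s where s: "t = Suc s" "s < n" by (cases t) auto
  let ?w = "\<lambda>i. grid J (x (Suc i))"
  have "Suc (cell ?w s) \<notin> dom (array_after alg x s)"
    unfolding dom_array_after_alg using cell_valid[OF s(2), of ?w] by auto
  then show "chosen_cell alg x t \<in> {1..n} \<and> array_after alg x (t - 1) (chosen_cell alg x t) = None"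
    using cell_valid[OF s(2), of ?w] by (auto simp: s(1) chosen_cell_alg)
qed

text \<open>The phase has about \<open>n / 2 ^ (j + 1)\<close> items, each displaced by at most
  \<open>2 * 2 ^ j\<close> grid steps, so the total is about \<open>n\<close> for every
  \<open>j\<close>. The summand 2 absorbs the rounding.\<close>

lemma phase_length_le:
  assumes "j < J"
  shows "(phase_start (Suc j) - phase_start j) * (2 * 2 ^ j) \<le> 2 ^ J * (n div 2 ^ J + 2)"
proof -
  let ?m = "n div 2 ^ j"
  have "phase_start (Suc j) - phase_start j = ?m - n div 2 ^ Suc j"
    using div_le_mono2[of "2 ^ j" "2 ^ Suc j" n] div_le_dividend[of n "2 ^ j"]
    unfolding phase_start_def by linarith
  also have "n div 2 ^ Suc j = ?m div 2"
    by (metis div_mult2_eq power_Suc2)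
  finally have "2 * (phase_start (Suc j) - phase_start j) \<le> ?m + 1"
    by linarith
  then have "2 * (phase_start (Suc j) - phase_start j) * 2 ^ j \<le> (?m + 1) * 2 ^ j"
    by (rule mult_right_mono) simp
  also have "\<dots> \<le> n + 2 ^ j"
    by (simp add: algebra_simps)
  also have "\<dots> \<le> 2 ^ J * (n div 2 ^ J + 1) + 2 ^ J"
  proof (rule add_mono)
    show "n \<le> 2 ^ J * (n div 2 ^ J + 1)"
      using dividend_less_div_times[of "2 ^ J" n] by (simp add: mult.commute)
    show "(2::nat) ^ j \<le> 2 ^ J" using assms by simp
  qed
  finally show ?thesis by (simp add: algebra_simps)
qed

lemma cost_alg_le:
  assumes x: "\<forall>t\<in>{1..n}. x t \<in> {0..1}" and bal: "balanced (\<lambda>i. grid J (x (Suc i)))"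
    and n: "2 ^ J \<le> n" and c: "c \<le> n div 2 ^ J"
  shows "sorting_cost n alg x \<le> 2 * (real J + 1) * (real (n div 2 ^ J) + 4)"
proof -
  define w where "w = (\<lambda>i. grid J (x (Suc i)))"
  define L where "L = labels w n"
  \<comment> \<open>The value 0 beyond \<open>L\<close> adds at most one descent, at index
    \<open>length L - 1\<close>.\<close>
  define f where "f i = (if i < length L then real (L ! i) / 2 ^ J else 0)" for i
  define q where "q = n div 2 ^ J"
  have range: "w t < 2 ^ J" if "t < n" for t
    unfolding w_def using x that by (intro grid_less) auto
  note inv = phase_inv_balanced[OF bal[folded w_def] range n c]
  have L_J: "L = labels w (phase_start J)"
    unfolding L_def by (rule labels_final[OF phase_start_le n])
  have L: "set L \<subseteq> {..<2 ^ J}" "card (descents L) \<le> J"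
    using inv[of J] unfolding phase_inv_def Let_def L_J by auto
  have L_less: "real (L ! i) < 2 ^ J" if "i < length L" for i
    using L(1) nth_mem[OF that] by (metis lessThan_iff of_nat_less_iff of_nat_numeral of_nat_power subsetD)
  then have f: "0 \<le> f i" "f i \<le> 1" for i
    unfolding f_def by (auto simp: less_imp_le)
  have "(\<Sum>i<n - 1. \<bar>f (Suc i) - f i\<bar>) \<le> 1 + 2 * 1 * real (card (insert (length L - 1) (descents L)))"
  proof (rule sum_abs_diff_le_if_few_descents[OF f])
    fix i assume "f (Suc i) < f i"
    then show "i \<in> insert (length L - 1) (descents L)"
      by (auto simp: f_def descents_def divide_less_cancel split: if_splits)
  qed simp
  also have "\<dots> \<le> 1 + 2 * (real J + 1)"
    using card_insert_le_m1[of "Suc J" "descents L"  "length L - 1"] L(2) by simp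
  finally have tv: "(\<Sum>i<n - 1. \<bar>f (Suc i) - f i\<bar>) \<le> 1 + 2 * (real J + 1)" .
  let ?d = "\<lambda>t. \<bar>x (Suc t) - f (cell w t)\<bar>"
  have d_phase: "?d t \<le> 2 * 2 ^ j / 2 ^ J"
    if j: "j < J" and t: "phase_start j \<le> t" "t < phase_start (Suc j)" for t j
  proof -
    have "t < n" using t phase_start_le[of "Suc j"] by simp
    then have xt: "0 \<le> x (Suc t)" using x by simp
    have *: "cell w t \<in> free (labels w (Suc t)) (occupied w t) j (w t div 2 ^ j)"
      using phase_step(2)[OF bal[folded w_def] range j n c inv[of j] t] j by simp
    obtain zs where "L = labels w (Suc t) @ zs"
      using labels_prefix[of "Suc t" n w] \<open>t < n\<close> unfolding L_def by auto
    then have cell: "cell w t < length L" "L ! cell w t div 2 ^ j = w t div 2 ^ j"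
      using * by (auto simp: free_def nth_append)
    \<comment> \<open>Sharing a bucket costs less than \<open>2 ^ j\<close> grid steps; rounding the
      item costs at most one more, and \<open>1 \<le> 2 ^ j\<close>.\<close>
    have "\<bar>real (L ! cell w t) - real (w t)\<bar> < 2 ^ j"
      using abs_diff_less_if_div_eq[OF cell(2)] by simp
    moreover have "real (w t) \<le> 2 ^ J * x (Suc t)" "2 ^ J * x (Suc t) \<le> real (w t) + 1"
      unfolding w_def using grid_bounds[OF xt] by auto
    moreover have "(1::real) \<le> 2 ^ j" by simp
    ultimately have "\<bar>2 ^ J * x (Suc t) - real (L ! cell w t)\<bar> \<le> 2 * 2 ^ j"
      by linarith
    moreover have "2 ^ J * x (Suc t) - real (L ! cell w t) = 2 ^ J * (x (Suc t) - f (cell w t))"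
      using cell(1) by (simp add: f_def field_simps)
    ultimately have "\<bar>2 ^ J * (x (Suc t) - f (cell w t))\<bar> \<le> 2 * 2 ^ j"
      by simp
    then have "2 ^ J * \<bar>x (Suc t) - f (cell w t)\<bar> \<le> 2 * 2 ^ j"
      by (simp only: abs_mult) simp
    then show ?thesis
      by (simp add: pos_le_divide_eq mult.commute)
  qed
  have "(\<Sum>t<phase_start j. ?d t) \<le> real j * (real q + 2)" if "j \<le> J" for j
    using that
  proof (induction j)
    case (Suc j)
    have "{..<phase_start (Suc j)} = {..<phase_start j} \<union> {phase_start j..<phase_start (Suc j)}"
      using phase_start_mono[of j "Suc j"] by auto
    then have "(\<Sum>t<phase_start (Suc j). ?d t) =
      (\<Sum>t<phase_start j. ?d t) + (\<Sum>t = phase_start j..<phase_start (Suc j). ?d t)"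
      by (simp add: sum.union_disjoint ivl_disj_int)
    also have "(\<Sum>t = phase_start j..<phase_start (Suc j). ?d t) \<le>
      (\<Sum>t = phase_start j..<phase_start (Suc j). 2 * 2 ^ j / 2 ^ J)"
      using Suc.prems by (intro sum_mono d_phase) auto
    also have "\<dots> = real ((phase_start (Suc j) - phase_start j) * (2 * 2 ^ j)) / 2 ^ J"
      by simp
    also have "\<dots> \<le> real (2 ^ J * (q + 2)) / 2 ^ J"
      using phase_length_le[of j] Suc.prems unfolding q_def
      by (intro divide_right_mono of_nat_mono) auto
    also have "\<dots> = real q + 2" by (simp add: field_simps)
    finally show ?case using Suc by (simp add: algebra_simps)
  qed simp
  then have d1: "(\<Sum>t<phase_start J. ?d t) \<le> real J * (real q + 2)" by blast
  \<comment> \<open>Only \<open>q\<close> items remain after the last phase, so the trivial bound 1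
    on each displacement suffices.\<close>
  have "(\<Sum>t = phase_start J..<n. ?d t) \<le> (\<Sum>t = phase_start J..<n. 1)"
  proof (rule sum_mono)
    fix t assume "t \<in> {phase_start J..<n}"
    then have "x (Suc t) \<in> {0..1}" using x by simp
    then show "?d t \<le> 1" using f[of "cell w t"] by auto
  qed
  also have "\<dots> = real q"
    unfolding phase_start_def q_def by simp
  finally have d2: "(\<Sum>t = phase_start J..<n. ?d t) \<le> real q" .
  have "(\<Sum>t = 1..n. \<bar>x t - f (chosen_cell alg x t - 1)\<bar>) = (\<Sum>t<n. ?d t)"
    by (rule sum.reindex_bij_witness[of _ Suc "\<lambda>t. t - 1"])
      (auto simp: chosen_cell_alg w_def Suc_le_eq dest: gr0_implies_Suc)
  also have "{..<n} = {..<phase_start J} \<union> {phase_start J..<n}"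
    using phase_start_le[of J] by auto
  then have "(\<Sum>t<n. ?d t) = (\<Sum>t<phase_start J. ?d t) + (\<Sum>t = phase_start J..<n. ?d t)"
    by (simp add: sum.union_disjoint ivl_disj_int)
  finally have "(\<Sum>t = 1..n. \<bar>x t - f (chosen_cell alg x t - 1)\<bar>) \<le> real J * (real q + 2) + real q"
    using d1 d2 by linarith
  then have "sorting_cost n alg x \<le> 1 + 2 * (real J + 1) + 2 * (real J * (real q + 2) + real q)"
    by (intro order_trans[OF sorting_cost_le[OF valid_alg x, of f]] add_mono[OF tv] mult_left_mono) simp_all
  also have "\<dots> \<le> 2 * (real J + 1) * (real q + 4)"
    by (simp add: algebra_simps)
  finally show ?thesis by (simp add: q_def)
qed

subsection \<open>Balanced inputs are likely\<close>

text \<open>The items enter only through a finite list of grid points. Such lists form a countable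
  type with the discrete sigma-algebra, so \<open>cell\<close> needs no analysis of its own.\<close>

lemma measurable_chosen_cell:
  assumes "t < n"
  shows "(\<lambda>x. chosen_cell alg x (Suc t)) \<in> uniform_items n \<rightarrow>\<^sub>M count_space UNIV"
proof -
  have "chosen_cell alg x (Suc t) =
      Suc (cell ((!) (map (\<lambda>i. grid J (x (Suc i))) [0..<Suc t])) t)" for x
  proof -
    have "cell (\<lambda>i. grid J (x (Suc i))) t = cell ((!) (map (\<lambda>i. grid J (x (Suc i))) [0..<Suc t])) t"
      by (rule cell_cong) (simp del: upt_Suc)
    then show ?thesis by (simp add: chosen_cell_alg)
  qed
  moreover have "(\<lambda>x. map (\<lambda>i. grid J (x (Suc i))) [0..<Suc t])
      \<in> uniform_items n \<rightarrow>\<^sub>M count_space UNIV"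
    by (rule measurable_list_of_items, rule measurable_compose[OF measurable_item grid_borel])
      (use assms in simp)
  ultimately show ?thesis
    by (simp only:) (erule measurable_compose, simp)
qed

lemma borel_measurable_array_after:
  assumes "t \<le> n"
  shows "(\<lambda>x. the (array_after alg x t i)) \<in> borel_measurable (uniform_items n)"
  using assms
proof (induction t)
  case (Suc t)
  have "the (array_after alg x (Suc t) i) =
      (if chosen_cell alg x (Suc t) = i then x (Suc t) else the (array_after alg x t i))" for x
    by simp
  moreover have [measurable]: "(\<lambda>x. the (array_after alg x t i)) \<in> borel_measurable (uniform_items n)"
    using Suc by simp
  moreover have [measurable]: "(\<lambda>x. x (Suc t)) \<in> borel_measurable (uniform_items n)"
    using Suc.prems by (intro measurable_item) simp
  moreover have [measurable]: "(\<lambda>x. chosen_cell alg x (Suc t)) \<in> uniform_items n \<rightarrow>\<^sub>M count_space UNIV"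
    using Suc.prems by (intro measurable_chosen_cell) simp
  ultimately show ?case
    by (simp only:) measurable
qed simp

lemma borel_measurable_sorting_cost: "sorting_cost n alg \<in> borel_measurable (uniform_items n)"
  unfolding sorting_cost_def
  by (intro borel_measurable_sum borel_measurable_abs borel_measurable_diff
      borel_measurable_array_after order_refl)

section \<open>Tail bounds for the arrivals in a bucket\<close>

definition bucket :: "nat \<Rightarrow> nat \<Rightarrow> real set" where
  "bucket j b = {y. grid J y div 2 ^ j = b}"

definition hits :: "nat \<Rightarrow> nat \<Rightarrow> (nat \<Rightarrow> real) \<Rightarrow> nat" where
  "hits j b x = card {t \<in> {Suc (phase_start j)..phase_start (Suc j)}. x t \<in> bucket j b}"

lemma arrivals_eq_hits:
  "arrivals (\<lambda>i. grid J (x (Suc i))) j b (phase_start (Suc j)) = hits j b x"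
  unfolding arrivals_def hits_def bucket_def
  by (rule bij_betw_same_card[of Suc], rule bij_betwI[where g = "\<lambda>i. i - 1"]) auto

text \<open>\<open>m\<close> is the expected number of arrivals in a bucket. The upper bound is
  \<open>phase_length_le\<close>; the lower one holds because a phase takes at least half of the
  remaining items.\<close>

lemma phase_mean:
  assumes "j < J"
  defines "m \<equiv> real (phase_start (Suc j) - phase_start j) / 2 ^ (J - j)"
  shows "real (n div 2 ^ J) / 2 \<le> m" "m \<le> real (n div 2 ^ J) / 2 + 1"
proof -
  let ?t = "phase_start (Suc j) - phase_start j" and ?q = "n div 2 ^ J"
  have J: "(2::real) ^ J = 2 ^ (J - j) * 2 ^ j"
    using assms by (simp flip: power_add)
  have "real (?t * (2 * 2 ^ j)) \<le> real (2 ^ J * (?q + 2))"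
    using phase_length_le[OF assms(1)] unfolding of_nat_le_iff .
  then have "(real ?t * 2) * 2 ^ j \<le> (2 ^ (J - j) * (real ?q + 2)) * 2 ^ j"
    by (simp only: J of_nat_mult of_nat_add of_nat_power of_nat_numeral mult_ac)
  then have "real ?t * 2 \<le> 2 ^ (J - j) * (real ?q + 2)"
    by (rule mult_right_le_imp_le) simp
  then show "m \<le> real ?q / 2 + 1"
    unfolding m_def by (simp add: field_simps)
  have "n div 2 ^ J = n div 2 ^ j div 2 ^ (J - j)"
    using assms by (simp flip: div_mult2_eq power_add)
  then have "2 ^ (J - j) * ?q \<le> n div 2 ^ j"
    by (simp only: times_div_less_eq_dividend)
  moreover have "n div 2 ^ j \<le> 2 * ?t"
  proof -
    have "n div 2 ^ Suc j = n div 2 ^ j div 2"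
      by (metis div_mult2_eq power_Suc2)
    then show ?thesis
      using div_le_dividend[of n "2 ^ j"] unfolding phase_start_def by linarith
  qed
  ultimately have "real (2 ^ (J - j) * ?q) \<le> real (2 * ?t)"
    unfolding of_nat_le_iff by (rule order_trans)
  then show "real ?q / 2 \<le> m"
    unfolding m_def by (simp add: field_simps)
qed

lemma borel_measurable_hits [measurable]:
  "(\<lambda>x. real (hits j b x)) \<in> borel_measurable (uniform_items n)"
  unfolding hits_def
  by (rule borel_measurable_card_hits) (use phase_start_le[of "Suc j"] in \<open>auto simp: bucket_def\<close>)

text \<open>Chernoff with \<open>l = 1/6\<close> and \<open>l = -1/6\<close> at the thresholds
  \<open>2 * q / 3\<close> and \<open>q / 3\<close>, on either side of the mean near
  \<open>q / 2\<close>. The exponents are \<open>7/72 - 8/72\<close> and \<open>-5/72 + 4/72\<close>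
  times \<open>q\<close>; the factor 2 absorbs the excess of the mean over
  \<open>q / 2\<close>.\<close>

lemma prob_bucket_unbalanced:
  assumes j: "j < J" and b: "b < 2 ^ (J - j)" and c: "c = 2 * (n div 2 ^ J) div 3"
  shows "measure (uniform_items n) {x \<in> space (uniform_items n). c < hits j b x} 
      \<le> 2 * exp (- real (n div 2 ^ J) / 72)"
    and "measure (uniform_items n) {x \<in> space (uniform_items n). 2 * hits j b x < c} 
      \<le> exp (- real (n div 2 ^ J) / 72)"
proof -
  interpret prob_space "uniform_items n" by (rule prob_space_uniform_items)
  define q where "q = n div 2 ^ J"
  let ?T = "{Suc (phase_start j)..phase_start (Suc j)}" and ?B = "bucket j b"
  define m where "m = real (phase_start (Suc j) - phase_start j) / 2 ^ (J - j)"
  have T: "?T \<subseteq> {1..n}" using phase_start_le[of "Suc j"] by auto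
  have B: "?B \<in> sets borel" unfolding bucket_def by measurable
  have m: "real (card ?T) * measure unit_uniform ?B = m"
    using measure_grid_bucket[of j J b] j b by (simp add: m_def bucket_def)
  have mq: "real q / 2 \<le> m" "m \<le> real q / 2 + 1"
    using phase_mean[OF j] by (simp_all add: m_def q_def)
  note chernoff = chernoff_card_hits[OF T B, unfolded m, folded hits_def]
  have events: "{x \<in> space (uniform_items n). l * a \<le> l * real (hits j b x)} \<in> sets (uniform_items n)"
    for l a :: real
    using borel_measurable_hits by measurable
  have exp_up: "exp (1 / 6 :: real) - 1 \<le> 7 / 36"
    using exp_bound[of "1 / 6"] by (simp add: power2_eq_square)
  have exp_low: "exp (- 1 / 6 :: real) - 1 \<le> - 5 / 36"
  proof -
    have "7 / 6 \<le> exp (1 / 6 :: real)"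
      using exp_ge_add_one_self[of "1 / 6 :: real"] by simp
    then have "inverse (exp (1 / 6 :: real)) \<le> inverse (7 / 6)"
      by (intro le_imp_inverse_le) auto
    then show ?thesis by (simp add: exp_minus)
  qed
  have "prob {x \<in> space (uniform_items n). c < hits j b x} \<le>
      prob {x \<in> space (uniform_items n). 1 / 6 * (2 * real q / 3) \<le> 1 / 6 * real (hits j b x)}"
  proof (rule finite_measure_mono[OF _ events], safe)
    fix x assume "c < hits j b x"
    then have "2 * q < 3 * hits j b x" using c unfolding q_def by linarith
    then show "1 / 6 * (2 * real q / 3) \<le> 1 / 6 * real (hits j b x)" by linarith
  qed
  also have "\<dots> \<le> exp (m * (exp (1 / 6) - 1) - 1 / 6 * (2 * real q / 3))"
    by (rule chernoff)
  also have "\<dots> \<le> exp (7 / 36 + - real q / 72)"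
  proof -
    have "m * (exp (1 / 6) - 1) \<le> (real q / 2 + 1) * (7 / 36)"
      using mq exp_up by (intro mult_mono) auto
    then show ?thesis by simp
  qed
  also have "\<dots> = exp (7 / 36) * exp (- real q / 72)" by (rule exp_add)
  also have "\<dots> \<le> 2 * exp (- real q / 72)"
  proof (rule mult_right_mono)
    show "exp (7 / 36 :: real) \<le> 2"
      using exp_bound[of "7 / 36"] by (simp add: power2_eq_square)
  qed simp
  finally show "prob {x \<in> space (uniform_items n). c < hits j b x} \<le> 2 * exp (- real (n div 2 ^ J) / 72)"
    by (simp add: q_def)
  have "prob {x \<in> space (uniform_items n). 2 * hits j b x < c} \<le>
      prob {x \<in> space (uniform_items n). - 1 / 6 * (real q / 3) \<le> - 1 / 6 * real (hits j b x)}"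
  proof (rule finite_measure_mono[OF _ events], safe)
    fix x assume "2 * hits j b x < c"
    then have "3 * hits j b x \<le> q" using c unfolding q_def by linarith
    then show "- 1 / 6 * (real q / 3) \<le> - 1 / 6 * real (hits j b x)" by linarith
  qed
  also have "\<dots> \<le> exp (m * (exp (- 1 / 6) - 1) - (- 1 / 6) * (real q / 3))"
    by (rule chernoff)
  also have "\<dots> \<le> exp (- real q / 72)"
  proof -
    have "m * (exp (- 1 / 6) - 1) \<le> m * (- 5 / 36)"
      using mq exp_low by (intro mult_left_mono) auto
    then show ?thesis using mq by simp
  qed
  finally show "prob {x \<in> space (uniform_items n). 2 * hits j b x < c} \<le> exp (- real (n div 2 ^ J) / 72)"
    by (simp add: q_def)
qed

text \<open>Union bound: all phases together have at most \<open>2 * 2 ^ J\<close> buckets, each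
  failing with probability at most three times the exponential. For \<open>J = 0\<close> there is no
  bucket to check.\<close>

lemma prob_balanced:
  assumes c: "c = 2 * (n div 2 ^ J) div 3"
  defines "G \<equiv> {x \<in> space (uniform_items n). balanced (\<lambda>i. grid J (x (Suc i)))}"
  shows "G \<in> sets (uniform_items n)"
    and "measure (uniform_items n) G \<ge> 1 - 6 * 2 ^ J * exp (- real (n div 2 ^ J) / 72)"
    and "J = 0 \<Longrightarrow> measure (uniform_items n) G = 1"
proof -
  interpret prob_space "uniform_items n" by (rule prob_space_uniform_items)
  define I where "I = (SIGMA j:{..<J}. {..<2 ^ (J - j) :: nat})"
  define Hi where "Hi = (\<lambda>(j, b). {x \<in> space (uniform_items n). c < hits j b x})"
  define Lo where "Lo = (\<lambda>(j, b). {x \<in> space (uniform_items n). 2 * hits j b x < c})"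
  let ?e = "exp (- real (n div 2 ^ J) / 72)"
  have fin: "finite I" unfolding I_def by auto
  have sets: "Hi i \<in> events" "Lo i \<in> events" for i
  proof -
    obtain j b where i: "i = (j, b)" by force
    have "Hi i = {x \<in> space (uniform_items n). real c < real (hits j b x)}"
      "Lo i = {x \<in> space (uniform_items n). 2 * real (hits j b x) < real c}"
      by (auto simp: Hi_def Lo_def i)
    then show "Hi i \<in> events" "Lo i \<in> events"
      by (simp_all only:) measurable
  qed
  have G: "G = space (uniform_items n) - (\<Union>i\<in>I. Hi i \<union> Lo i)"
    unfolding G_def balanced_def arrivals_eq_hits I_def Hi_def Lo_def
    by (auto simp flip: not_le)
  show "G \<in> events"
    unfolding G using fin sets by auto
  have compl: "prob G = 1 - prob (\<Union>i\<in>I. Hi i \<union> Lo i)"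
    unfolding G using fin sets by (intro prob_compl) auto
  then show "prob G = 1" if "J = 0"
    using that by (simp add: I_def)
  have "prob (\<Union>i\<in>I. Hi i \<union> Lo i) \<le> (\<Sum>i\<in>I. prob (Hi i \<union> Lo i))"
    using sets fin by (intro finite_measure_subadditive_finite) auto
  also have "\<dots> \<le> (\<Sum>i\<in>I. 3 * ?e)"
  proof (rule sum_mono)
    fix i assume "i \<in> I"
    then obtain j b where i: "i = (j, b)" "j < J" "b < 2 ^ (J - j)" by (auto simp: I_def)
    have "prob (Hi i \<union> Lo i) \<le> prob (Hi i) + prob (Lo i)"
      using sets by (intro measure_Un_le)
    also have "\<dots> \<le> 2 * ?e + ?e"
      using prob_bucket_unbalanced[OF i(2,3) c] unfolding Hi_def Lo_def i(1) by (intro add_mono) auto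
    finally show "prob (Hi i \<union> Lo i) \<le> 3 * ?e" by simp
  qed
  also have "\<dots> = real (card I) * (3 * ?e)" by simp
  also have "\<dots> \<le> (2 * 2 ^ J) * (3 * ?e)"
  proof (rule mult_right_mono)
    have "card I = (\<Sum>j<J. 2 ^ (J - j))"
      unfolding I_def by (subst card_SigmaI) auto
    also have "\<dots> \<le> 2 * 2 ^ J"
    proof (induction J)
      case (Suc J)
      have "(\<Sum>j<Suc J. 2 ^ (Suc J - j)) = 2 ^ Suc J + (\<Sum>j<J. 2 ^ (J - j) :: nat)"
        by (subst sum.lessThan_Suc_shift) simp
      then show ?case using Suc by simp
    qed simp
    finally have "real (card I) \<le> real (2 * 2 ^ J)"
      unfolding of_nat_le_iff .
    then show "real (card I) \<le> 2 * 2 ^ J" by simp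
  qed simp
  finally show "prob G \<ge> 1 - 6 * 2 ^ J * ?e"
    unfolding compl by simp
qed

end

section \<open>Choice of the scale and the final estimate\<close>

theorem theorem3:
  "\<exists>C k :: real. C > 0 \<and> k > 0 \<and>
     (\<forall>n::nat. n \<ge> 2 \<longrightarrow>
       (\<exists>alg. valid_online_alg n alg \<and>
          {x \<in> space (uniform_items n). sorting_cost n alg x \<le> C * ln (real n) powr k}
            \<in> sets (uniform_items n) \<and>
          measure (uniform_items n)
            {x \<in> space (uniform_items n). sorting_cost n alg x \<le> C * ln (real n) powr k}
            \<ge> 1 - C / real n ^ 10))"
proof (rule exI[of _ 20000], rule exI[of _ 2], intro conjI allI impI)
  show "(0::real) < 20000" "(0::real) < 2" by simp_all
  fix n :: nat assume n: "2 \<le> n"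
  \<comment> \<open>\<open>800 > 72 \<cdot> 11\<close>, so a given bucket is unbalanced with probability \<open>O(n\<^sup>-\<^sup>1\<^sup>1)\<close>.\<close>
  define r where "r = nat \<lceil>800 * ln n\<rceil>"
  have ln_half: "1 / 2 \<le> ln (real n)"
  proof -
    have "1 / 2 \<le> ln (2::real)" using ln2_ge_two_thirds by simp
    also have "\<dots> \<le> ln (real n)" using n by simp
    finally show ?thesis .
  qed
  have r: "800 * ln n \<le> real r" "real r \<le> 800 * ln n + 1"
    using ln_half unfolding r_def by linarith+
  have "0 < r" using r(1) ln_half by (cases r) auto
  then obtain J where J: "n div 2 ^ J < 2 * r" "J = 0 \<or> r \<le> n div 2 ^ J"
    using exists_scale by blast
  define q where "q = n div 2 ^ J"
  interpret bucket_placement n J "2 * q div 3" .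
  interpret prob_space "uniform_items n" by (rule prob_space_uniform_items)
  have "0 < n div 2 ^ J" using J n \<open>0 < r\<close> by auto
  then have n_J: "2 ^ J \<le> n" by (simp add: div_greater_zero_iff)
  define G where "G = {x \<in> space (uniform_items n). balanced (\<lambda>i. grid J (x (Suc i)))}"
  have G: "prob G \<ge> 1 - 6 * 2 ^ J * exp (- real q / 72)" "J = 0 \<Longrightarrow> prob G = 1"
    using prob_balanced by (simp_all add: G_def q_def)
  \<comment> \<open>For \<open>J = 0\<close> the quotient \<open>q = n\<close> may be too small for
    the tail bound, but then balance is vacuous. Otherwise the at most \<open>n\<close> factor
    \<open>2 ^ J\<close> costs one power of \<open>n\<close>.\<close>
  have "1 - 20000 / real n ^ 10 \<le> prob G"
  proof (cases "J = 0")
    case False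
    then have "800 * ln n \<le> real q" using J r unfolding q_def by linarith
    then have "- real q / 72 \<le> - (11 * ln n)" using ln_half by linarith
    then have "exp (- real q / 72) \<le> exp (- (11 * ln n))" by simp
    also have "\<dots> = 1 / real n ^ 11"
      using n exp_of_nat_mult[of 11 "ln (real n)"] by (simp add: exp_minus inverse_eq_divide)
    finally have "6 * 2 ^ J * exp (- real q / 72) \<le> 6 * real n * (1 / real n ^ 11)"
      using n_J by (intro mult_mono) (simp_all add: numeral_power_le_of_nat_cancel_iff)
    also have "\<dots> = 6 / real n ^ 10"
      using n power_Suc[of "real n" 10] by simp
    also have "\<dots> \<le> 20000 / real n ^ 10"
      by (intro divide_right_mono) auto
    finally show ?thesis using G by linarith
  qed (use G in simp)
  have cost: "sorting_cost n alg x \<le> 20000 * ln (real n) powr 2"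
    if "\<forall>t\<in>{1..n}. x t \<in> {0..1}" "x \<in> G" for x
  proof -
    have "real J * ln 2 \<le> ln (real n)"
    proof -
      have "real (2 ^ J) \<le> real n" using n_J unfolding of_nat_le_iff .
      with n have "ln (2 ^ J) \<le> ln (real n)" by (subst ln_le_cancel_iff) auto
      then show ?thesis by (simp add: ln_realpow)
    qed
    moreover have "real J * (1 / 2) \<le> real J * ln 2"
      using ln2_ge_two_thirds by (intro mult_left_mono) auto
    ultimately have J_le: "real J + 1 \<le> 4 * ln (real n)" using ln_half by linarith
    have "real q \<le> 2 * real r" using J unfolding q_def by linarith
    \<comment> \<open>\<open>2 * r + 4\<close> is at most \<open>1600 * ln n + 6\<close>, and
      \<open>6 \<le> 12 * ln n\<close>. With \<open>J_le\<close> the product is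
      \<open>12896 * (ln n)^2\<close>, below the constant 20000.\<close>
    then have q_le: "real q + 4 \<le> 1612 * ln (real n)" using r ln_half by linarith
    have "balanced (\<lambda>i. grid J (x (Suc i)))"
      using that(2) by (simp add: G_def)
    moreover have "2 * q div 3 \<le> q"
      by simp
    ultimately have "sorting_cost n alg x \<le> 2 * (real J + 1) * (real q + 4)"
      by (rule cost_alg_le[OF that(1) _ n_J, folded q_def])
    also have "\<dots> \<le> 2 * (4 * ln (real n)) * (1612 * ln (real n))"
      using J_le q_le ln_half by (intro mult_mono) auto
    also have "\<dots> \<le> 20000 * (ln (real n))\<^sup>2"
      by (simp add: power2_eq_square)
    finally show ?thesis
      using ln_half by (simp add: powr_numeral)
  qed
  let ?E = "{x \<in> space (uniform_items n). sorting_cost n alg x \<le> 20000 * ln (real n) powr 2}"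
  have E: "?E \<in> events"
    using borel_measurable_sorting_cost by measurable
  \<comment> \<open>The sample space contains all real-valued inputs, so the cost bound, which needs
    items in the unit interval, holds on \<open>G\<close> only almost everywhere.\<close>
  moreover have "AE x in uniform_items n. x \<in> G \<longrightarrow> x \<in> ?E"
    using AE_items_in_unit_interval by eventually_elim (use cost in \<open>auto simp: G_def\<close>)
  ultimately have "prob G \<le> prob ?E"
    by (intro finite_measure_mono_AE)
  with \<open>1 - 20000 / real n ^ 10 \<le> prob G\<close> have "1 - 20000 / real n ^ 10 \<le> prob ?E"
    by (rule order_trans)
  with valid_alg E
  show "\<exists>a. valid_online_alg n a \<and>
      {x \<in> space (uniform_items n). sorting_cost n a x \<le> 20000 * ln (real n) powr 2} \<in> events \<and>
      prob {x \<in> space (uniform_items n). sorting_cost n a x \<le> 20000 * ln (real n) powr 2}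
        \<ge> 1 - 20000 / real n ^ 10"
    by blast
qed

end
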